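(* A mapping $\varphi:\mathbb{R}_+\times\mathbb{R}\to\mathbb{R}$ is a non-degenerate semiflow if and only if there exists a continuous, strictly increasing function $\mu:\mathbb{R}\to\mathbb{R}$ with $\lim_{s\to-\infty}\mu(s)=-\infty$ and $$\varphi_t(s)=\mu^{-1}(\mu(s)-t)\quad\text{for all } t\ge 0 \text{ and } s\in\mathbb{R}.$$
   Context: $\mathbb{R}_+=[0,\infty)$ and $\varphi_t(s)=\varphi(t,s)$. A real semiflow is a continuous mapping $\varphi:\mathbb{R}_+\times\mathbb{R}\to\mathbb{R}$ such that (i) $\varphi_0(s)=s$ for all $s\in\mathbb{R}$; (ii) $\varphi_t\circ\varphi_\tau=\varphi_{t+\tau}$ for all $t,\tau\ge 0$; and (iii) $\varphi_t(s)\le s$ for all $t\ge 0$, $s\in\mathbb{R}$. The orbit of $s\in\mathbb{R}$ is $o(s)=\{\varphi_t(s): t\ge 0\}$; it is trivial if $o(s)=\{s\}$. A non-degenerate semiflow is a real semiflow without trivial orbits. For $\mu$ as in the claim, $\mu^{-1}$ denotes the inverse of $\mu$ regarded as a bijection from $\mathbb{R}$ onto its range $(-\infty,\ell)$, where $\ell=\lim_{s\to+\infty}\mu(s)\in\mathbb{R}\cup\{+\infty\}$; note that $\mu(s)-t$ lies in this range for $t\ge 0$. *)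

theory Defs
  imports "HOL-Analysis.Analysis"
begin

text \<open>
  A mapping from \<open>[0,\<infinity>) \<times> \<real>\<close> to \<open>\<real>\<close> is represented by a total function
  \<open>\<phi> :: real \<Rightarrow> real \<Rightarrow> real\<close>, where \<open>\<phi> t s\<close> is $\varphi_t(s)$. Its values at \<open>t < 0\<close> are
  irrelevant: every condition below is restricted to nonnegative times.
\<close>

definition real_semiflow :: "(real \<Rightarrow> real \<Rightarrow> real) \<Rightarrow> bool" where
  "real_semiflow \<phi> \<longleftrightarrow>
     continuous_on ({0..} \<times> UNIV) (\<lambda>(t, s). \<phi> t s) \<and>
     (\<forall>s. \<phi> 0 s = s) \<and>
     (\<forall>t\<ge>0. \<forall>\<tau>\<ge>0. \<phi> t \<circ> \<phi> \<tau> = \<phi> (t + \<tau>)) \<and>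
     (\<forall>t\<ge>0. \<forall>s. \<phi> t s \<le> s)"

definition orbit :: "(real \<Rightarrow> real \<Rightarrow> real) \<Rightarrow> real \<Rightarrow> real set" where
  "orbit \<phi> s = {\<phi> t s | t. t \<ge> 0}"

definition trivial_orbit :: "(real \<Rightarrow> real \<Rightarrow> real) \<Rightarrow> real \<Rightarrow> bool" where
  "trivial_orbit \<phi> s \<longleftrightarrow> orbit \<phi> s = {s}"

definition nondegenerate_semiflow :: "(real \<Rightarrow> real \<Rightarrow> real) \<Rightarrow> bool" where
  "nondegenerate_semiflow \<phi> \<longleftrightarrow> real_semiflow \<phi> \<and> (\<nexists>s. trivial_orbit \<phi> s)"

end

theory Submission
  imports Defs
begin

text \<open>
  When no orbit is trivial, every orbit runs strictly downwards and cannot stop at a finite limit,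
  because such a limit would be a fixed point. Hence any two points lie on a common orbit, and
  \<open>\<mu>\<close> is the signed travel time to the base point \<open>0\<close>, so that \<open>\<mu> (\<phi> t s) = \<mu> s - t\<close>. This equation
  makes \<open>\<mu>\<close> strictly increasing with range an open lower ray, and a monotone function
  with open range is continuous. Conversely, the same criterion gives the continuity of \<open>\<mu>\<^sup>-\<^sup>1\<close>.
\<close>

section \<open>From a semiflow to its conjugating function\<close>

locale nondegenerate_flow =
  fixes \<phi> :: "real \<Rightarrow> real \<Rightarrow> real"
  assumes nondegenerate: "nondegenerate_semiflow \<phi>"
begin

lemma flow_continuous: "continuous_on ({0..} \<times> UNIV) (\<lambda>(t, s). \<phi> t s)"
  and flow_0 [simp]: "\<phi> 0 s = s"
  and flow_le: "t \<ge> 0 \<Longrightarrow> \<phi> t s \<le> s"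
  and orbit_not_trivial: "\<not> trivial_orbit \<phi> s"
  using nondegenerate by (auto simp: nondegenerate_semiflow_def real_semiflow_def)

lemma flow_add: "\<lbrakk>t \<ge> 0; \<tau> \<ge> 0\<rbrakk> \<Longrightarrow> \<phi> (t + \<tau>) s = \<phi> t (\<phi> \<tau> s)"
  using nondegenerate by (simp add: nondegenerate_semiflow_def real_semiflow_def fun_eq_iff)

lemma flow_commute: "\<lbrakk>t \<ge> 0; \<tau> \<ge> 0\<rbrakk> \<Longrightarrow> \<phi> t (\<phi> \<tau> s) = \<phi> \<tau> (\<phi> t s)"
  by (simp add: add.commute flip: flow_add)

lemma continuous_on_flow_time: "continuous_on {0..} (\<lambda>t. \<phi> t s)"
proof -
  have "continuous_on {0..} ((\<lambda>(t, s). \<phi> t s) \<circ> (\<lambda>t. (t, s)))"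
    by (intro continuous_on_compose continuous_intros continuous_on_subset [OF flow_continuous]) auto
  then show ?thesis by (simp add: comp_def)
qed

lemma continuous_on_flow_space:
  assumes "t \<ge> 0"
  shows "continuous_on UNIV (\<phi> t)"
proof -
  have "continuous_on UNIV ((\<lambda>(t, s). \<phi> t s) \<circ> (\<lambda>s. (t, s)))"
    using assms
    by (intro continuous_on_compose continuous_intros continuous_on_subset [OF flow_continuous]) auto
  then show ?thesis by (simp add: comp_def)
qed

text \<open>Equality at a single positive time makes \<open>s\<close> periodic. A point that returns
  to its start cannot have moved, since the flow never increases, so its orbit would be
  trivial.\<close>

lemma flow_less:
  assumes "t > 0"
  shows "\<phi> t s < s"
proof (rule ccontr)
  assume "\<not> \<phi> t s < s"
  with flow_le [of t s] assms have fixed: "\<phi> t s = s" by simp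
  have period: "\<phi> (real n * t) s = s" for n
  proof (induction n)
    case (Suc n)
    then show ?case
      using assms fixed flow_add [of t "real n * t" s] by (simp add: algebra_simps)
  qed simp
  have "\<phi> r s = s" if "r \<ge> 0" for r
  proof -
    obtain n where n: "r < real n * t"
      using assms reals_Archimedean3 by blast
    \<comment> \<open>The multiple \<open>real n * t\<close> of the period overshoots
      \<open>r\<close>; flowing on from \<open>\<phi> r s\<close> for the remaining time leads back
      to \<open>s\<close>.\<close>
    have "s = \<phi> (real n * t - r + r) s"
      using period by simp
    also have "\<dots> = \<phi> (real n * t - r) (\<phi> r s)"
      using n that by (intro flow_add) auto
    also have "\<dots> \<le> \<phi> r s"
      using n by (intro flow_le) simp
    finally show ?thesis
      using flow_le [OF that, of s] by simp
  qed
  then have "orbit \<phi> s = {s}"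
    by (force simp: orbit_def)
  then show False
    using orbit_not_trivial by (simp add: trivial_orbit_def)
qed

lemma flow_time_less:
  assumes "0 \<le> t" "t < u"
  shows "\<phi> u s < \<phi> t s"
  using flow_add [of "u - t" t s] flow_less [of "u - t" "\<phi> t s"] assms by simp

lemma flow_time_inj: "\<lbrakk>0 \<le> t; 0 \<le> u; \<phi> t s = \<phi> u s\<rbrakk> \<Longrightarrow> t = u"
  using flow_time_less [of t u s] flow_time_less [of u t s] by linarith

text \<open>Along integer times an orbit bounded below decreases to a limit, which the continuous
  map \<open>\<phi> 1\<close> must fix, contrary to \<open>flow_less\<close>.\<close>

lemma orbit_unbounded: "\<exists>t\<ge>0. \<phi> t s < b"
proof (rule ccontr)
  assume "\<not> ?thesis"
  then have below: "b \<le> \<phi> (real n) s" for n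
    by (meson not_less of_nat_0_le_iff)
  have "decseq (\<lambda>n. \<phi> (real n) s)"
    by (rule decseq_SucI) (simp add: flow_time_less less_imp_le)
  then obtain L where L: "(\<lambda>n. \<phi> (real n) s) \<longlonglongrightarrow> L"
    using decseq_convergent [of "\<lambda>n. \<phi> (real n) s" b] below by blast
  have "isCont (\<phi> 1) L"
    using continuous_on_flow_space [of 1] by (simp add: continuous_on_eq_continuous_at)
  from isCont_tendsto_compose [OF this L]
  have "(\<lambda>n. \<phi> (real (Suc n)) s) \<longlonglongrightarrow> \<phi> 1 L"
    by (simp add: flow_add)
  then have "\<phi> 1 L = L"
    using LIMSEQ_unique LIMSEQ_Suc [OF L] by blast
  then show False
    using flow_less [of 1 L] by simp
qed

lemma flow_reaches:
  assumes "b \<le> a"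
  obtains t where "t \<ge> 0" "\<phi> t a = b"
proof -
  obtain u where "u \<ge> 0" "\<phi> u a < b"
    using orbit_unbounded by blast
  moreover have "continuous_on {0..u} (\<lambda>t. \<phi> t a)"
    by (rule continuous_on_subset [OF continuous_on_flow_time]) auto
  ultimately obtain t where "0 \<le> t" "\<phi> t a = b"
    using IVT2' [of "\<lambda>t. \<phi> t a" u b 0] assms by force
  then show thesis by (rule that)
qed

text \<open>Only nonnegative times are available, so a signed time is read off from a meeting of two
  forward orbits: \<open>s\<close> takes \<open>p\<close>, the base point \<open>0\<close> takes
  \<open>q\<close>. The value is positive for \<open>s\<close> above \<open>0\<close> and negative
  below.\<close>

definition travel_time :: "real \<Rightarrow> real" where
  "travel_time s = (THE r. \<exists>p\<ge>0. \<exists>q\<ge>0. r = p - q \<and> \<phi> p s = \<phi> q 0)"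

text \<open>Independence of the chosen meeting: delaying one meeting by \<open>q'\<close> and the
  other by \<open>q\<close> brings both to the same point of the orbit of \<open>0\<close>, and an
  orbit visits a point only once.\<close>

lemma travel_time_eq:
  assumes "p \<ge> 0" "q \<ge> 0" "\<phi> p s = \<phi> q 0"
  shows "travel_time s = p - q"
  unfolding travel_time_def
proof (rule the_equality)
  fix r
  assume "\<exists>p'\<ge>0. \<exists>q'\<ge>0. r = p' - q' \<and> \<phi> p' s = \<phi> q' 0"
  then obtain p' q' where r: "p' \<ge> 0" "q' \<ge> 0" "r = p' - q'" "\<phi> p' s = \<phi> q' 0"
    by blast
  have "\<phi> (q' + p) s = \<phi> q' (\<phi> q 0)"
    by (simp add: flow_add assms r(2))
  also have "\<dots> = \<phi> (q + p') s"
    by (simp add: flow_add flow_commute [of q' q] assms(2) r)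
  finally have "q' + p = q + p'"
    by (rule flow_time_inj [rotated 2]) (simp_all add: assms r)
  then show "r = p - q" using r by simp
qed (use assms in blast)

lemma flow_meets_base:
  obtains p q where "p \<ge> 0" "q \<ge> 0" "\<phi> p s = \<phi> q 0"
proof (cases "s \<ge> 0")
  case True
  then obtain p where "p \<ge> 0" "\<phi> p s = 0" by (rule flow_reaches)
  then show thesis using that [of p 0] by simp
next
  case False
  then obtain q where "q \<ge> 0" "\<phi> q 0 = s" by (meson flow_reaches linear)
  then show thesis using that [of 0 q] by simp
qed

text \<open>A meeting of \<open>s\<close> with the base at times \<open>p\<close>, \<open>q\<close>
  yields one of \<open>\<phi> t s\<close> with the base at times \<open>p\<close>,
  \<open>t + q\<close>.\<close>

lemma travel_time_flow:
  assumes "t \<ge> 0"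
  shows "travel_time (\<phi> t s) = travel_time s - t"
proof -
  obtain p q where pq: "p \<ge> 0" "q \<ge> 0" "\<phi> p s = \<phi> q 0"
    by (rule flow_meets_base)
  have "\<phi> p (\<phi> t s) = \<phi> (t + q) 0"
    using assms pq by (simp add: flow_add flow_commute [of p t])
  then show ?thesis
    using assms pq travel_time_eq [of p q s] travel_time_eq [of p "t + q" "\<phi> t s"] by simp
qed

lemma strict_mono_travel_time: "strict_mono travel_time"
proof (rule strict_monoI)
  fix a b :: real
  assume "a < b"
  then obtain t where t: "t \<ge> 0" "\<phi> t b = a"
    by (meson flow_reaches less_imp_le)
  with \<open>a < b\<close> have "t \<noteq> 0" by auto
  with t show "travel_time a < travel_time b"
    using travel_time_flow [of t b] by simp
qed

lemma range_travel_time_below: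
  assumes "y \<le> travel_time s"
  shows "y \<in> range travel_time"
proof
  show "y = travel_time (\<phi> (travel_time s - y) s)"
    using assms by (simp add: travel_time_flow)
qed simp

lemma continuous_on_travel_time: "continuous_on UNIV travel_time"
proof (rule continuous_onI_mono)
  have "\<exists>a > y. {..<a} \<subseteq> range travel_time" if "y \<in> range travel_time" for y
  proof -
    from that obtain s where s: "y = travel_time s" by blast
    \<comment> \<open>The range is closed downwards; this larger value shows that it has no maximum,
      hence that it is open.\<close>
    have "y < travel_time (s + 1)"
      using strict_mono_travel_time by (simp add: s strict_mono_less)
    then show ?thesis
      using range_travel_time_below by (metis lessThan_iff less_imp_le subsetI)
  qed
  then show "open (range travel_time)"
    by (subst open_subopen) (metis lessThan_iff open_lessThan)
qed (simp add: strict_mono_travel_time strict_mono_less_eq)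

lemma filterlim_travel_time: "filterlim travel_time at_bot at_bot"
  unfolding filterlim_at_bot eventually_at_bot_linorder
proof
  fix z
  \<comment> \<open>The range may be bounded above, so \<open>z\<close> itself need not be attained;
    the minimum with an attained value is.\<close>
  have "min z (travel_time 0) \<in> range travel_time"
    by (rule range_travel_time_below [of _ 0]) simp
  then obtain s where "travel_time s \<le> z"
    by (metis imageE min.cobounded1)
  then show "\<exists>N. \<forall>n\<le>N. travel_time n \<le> z"
    by (meson order_trans strict_mono_less_eq strict_mono_travel_time)
qed

lemma flow_eq_inv_travel_time:
  assumes "t \<ge> 0"
  shows "\<phi> t s = inv travel_time (travel_time s - t)"
  using strict_mono_imp_inj_on [OF strict_mono_travel_time]
  by (simp flip: travel_time_flow [OF assms])

end

section \<open>From a conjugating function to the semiflow\<close>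

locale conjugating_map =
  fixes \<mu> :: "real \<Rightarrow> real"
  assumes continuous: "continuous_on UNIV \<mu>"
    and strict_mono: "strict_mono \<mu>"
    and at_bot: "filterlim \<mu> at_bot at_bot"
begin

lemma inv_map [simp]: "inv \<mu> (\<mu> s) = s"
  by (simp add: strict_mono strict_mono_imp_inj_on)

lemma range_below:
  assumes "y \<le> \<mu> s"
  shows "y \<in> range \<mu>"
proof -
  \<comment> \<open>The minimum of \<open>s\<close> and a threshold below which \<open>\<mu>\<close>
    stays under \<open>y\<close> serves as \<open>a\<close>, the left end of an interval for the
    intermediate value theorem.\<close>
  obtain a where "\<mu> a \<le> y" "a \<le> s"
    using at_bot unfolding filterlim_at_bot eventually_at_bot_linorder
    by (metis min.cobounded1 min.cobounded2)
  moreover have "continuous_on {a..s} \<mu>"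
    using continuous continuous_on_subset by blast
  ultimately show ?thesis
    using IVT' [of \<mu> a y s] assms by blast
qed

lemma map_inv:
  assumes "t \<ge> 0"
  shows "\<mu> (inv \<mu> (\<mu> s - t)) = \<mu> s - t"
  using assms by (intro f_inv_into_f range_below [of _ s]) simp

text \<open>The image of the monotone map \<open>inv \<mu>\<close> is the whole line, which is
  open.\<close>

lemma continuous_on_inv: "continuous_on (range \<mu>) (inv \<mu>)"
proof (rule continuous_onI_mono)
  have "inv \<mu> ` range \<mu> = UNIV"
    by (auto simp: image_image)
  then show "open (inv \<mu> ` range \<mu>)" by simp
qed (auto simp: strict_mono strict_mono_less_eq)

text \<open>In the coordinate \<open>\<mu>\<close> the map \<open>\<phi> t\<close> is translation by
  \<open>-t\<close>; composition, descent and absence of fixed points carry over from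
  translations.\<close>

lemma nondegenerate_semiflow_conjugate:
  assumes \<phi>: "\<And>t s. t \<ge> 0 \<Longrightarrow> \<phi> t s = inv \<mu> (\<mu> s - t)"
  shows "nondegenerate_semiflow \<phi>"
proof -
  have map_\<phi>: "\<mu> (\<phi> t s) = \<mu> s - t" if "t \<ge> 0" for t s
    using that by (simp add: \<phi> map_inv)
  \<comment> \<open>Continuity of \<open>inv \<mu>\<close> is known on \<open>range \<mu>\<close>
    only, so the translated values must stay there.\<close>
  have "\<mu> s - t \<in> range \<mu>" if "t \<ge> 0" for t s
    using that by (intro range_below [of _ s]) simp
  then have "continuous_on ({0..} \<times> UNIV) (\<lambda>x. inv \<mu> (\<mu> (snd x) - fst x))"
    by (intro continuous_on_compose2 [OF continuous_on_inv] continuous_intros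
        continuous_on_compose2 [OF continuous]) auto
  then have "continuous_on ({0..} \<times> UNIV) (\<lambda>(t, s). \<phi> t s)"
    by (rule continuous_on_eq) (auto simp: \<phi>)
  moreover have "\<phi> t \<circ> \<phi> \<tau> = \<phi> (t + \<tau>)" if "t \<ge> 0" "\<tau> \<ge> 0" for t \<tau>
    using that by (simp add: fun_eq_iff \<phi> map_inv algebra_simps)
  moreover have "\<phi> t s \<le> s" if "t \<ge> 0" for t s
    using that map_\<phi> [OF that, of s] strict_mono_less_eq [OF strict_mono, of "\<phi> t s" s] by simp
  moreover have "\<not> trivial_orbit \<phi> s" for s
  proof
    assume "trivial_orbit \<phi> s"
    moreover have "\<phi> 1 s \<in> orbit \<phi> s"
      unfolding orbit_def by force
    ultimately have "\<phi> 1 s = s" by (simp add: trivial_orbit_def)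
    then show False using map_\<phi> [of 1 s] by simp
  qed
  ultimately show ?thesis
    by (simp add: nondegenerate_semiflow_def real_semiflow_def \<phi>)
qed

end

theorem theorem2p5:
  fixes \<phi> :: "real \<Rightarrow> real \<Rightarrow> real"
  shows "nondegenerate_semiflow \<phi> \<longleftrightarrow>
    (\<exists>\<mu> :: real \<Rightarrow> real.
       continuous_on UNIV \<mu> \<and> strict_mono \<mu> \<and> filterlim \<mu> at_bot at_bot \<and>
       (\<forall>t\<ge>0. \<forall>s. \<phi> t s = inv \<mu> (\<mu> s - t)))"
proof
  assume "nondegenerate_semiflow \<phi>"
  then interpret nondegenerate_flow \<phi> by unfold_locales
  show "\<exists>\<mu> :: real \<Rightarrow> real.
       continuous_on UNIV \<mu> \<and> strict_mono \<mu> \<and> filterlim \<mu> at_bot at_bot \<and>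
       (\<forall>t\<ge>0. \<forall>s. \<phi> t s = inv \<mu> (\<mu> s - t))"
    using continuous_on_travel_time strict_mono_travel_time filterlim_travel_time
      flow_eq_inv_travel_time by blast
next
  assume "\<exists>\<mu> :: real \<Rightarrow> real.
       continuous_on UNIV \<mu> \<and> strict_mono \<mu> \<and> filterlim \<mu> at_bot at_bot \<and>
       (\<forall>t\<ge>0. \<forall>s. \<phi> t s = inv \<mu> (\<mu> s - t))"
  then obtain \<mu> :: "real \<Rightarrow> real" where "conjugating_map \<mu>"
    and "\<And>t s. t \<ge> 0 \<Longrightarrow> \<phi> t s = inv \<mu> (\<mu> s - t)"
    by (auto simp: conjugating_map_def)
  then show "nondegenerate_semiflow \<phi>"
    by (rule conjugating_map.nondegenerate_semiflow_conjugate)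
qed

end
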